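(* Let $r\ge 1$ and let $\Gamma \cong (\mathbb{Z}/2^r\mathbb{Z},\langle\cdot,\cdot\rangle)$ be a cyclic $2$-group with non-exceptional pairing $\langle\cdot,\cdot\rangle$. Then there exists a graph $G$ such that $\Gamma \cong \mathrm{Jac}(G)$ as groups with pairing.
   Context: A group with pairing is a finite abelian group $\Gamma$ together with a symmetric, bilinear, non-degenerate pairing $\langle\cdot,\cdot\rangle : \Gamma\times\Gamma \to \mathbb{Q}/\mathbb{Z}$; an isomorphism of groups with pairing is a group isomorphism preserving the pairings. The non-exceptional pairings on $\mathbb{Z}/2^r\mathbb{Z}$ are, up to isomorphism, the following: $\langle x,y\rangle = \frac{xy}{2^r}$ (for $r\ge1$), $\langle x,y\rangle=\frac{-xy}{2^r}$ (for $r\ge 2$), $\langle x,y\rangle=\frac{5xy}{2^r}$ (for $r\ge3$), and $\langle x,y\rangle=\frac{-5xy}{2^r}$ (for $r\ge 3$). A graph is a finite connected graph, possibly with multiple edges, but without loops. A divisor on $G$ is a formal integral combination $D=\sum_{v\in V(G)} D(v)v$, of degree $\sum_v D(v)$. For $f: V(G)\to\mathbb{Z}$ put $\mathrm{ord}_v(f)=\sum_{e=vw}(f(v)-f(w))$, the sum being over edges $e$ containing $v$ (counted with multiplicity), and $\mathrm{div}(f)=\sum_v \mathrm{ord}_v(f)v$. Divisors of the form $\mathrm{div}(f)$ are principal. The Jacobian $\mathrm{Jac}(G)$ is the (finite) group of degree-zero divisors modulo principal divisors. It carries the monodromy pairing: for degree-zero divisors $D_1,D_2$, choose an integer $m\geq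 1$ and $f: V(G)\to\mathbb{Z}$ with $\mathrm{div}(f)=mD_1$, and set $\langle D_1,D_2\rangle=\frac1m\sum_{v\in V(G)} D_2(v)f(v) \in \mathbb{Q}/\mathbb{Z}$. As a group with pairing, $\mathrm{Jac}(G)$ is always equipped with this pairing. *)

theory Defs
  imports "HOL-Algebra.Free_Abelian_Groups" "HOL-Library.Multiset"
begin

section \<open>Groups with pairing\<close>

definition rat_group :: "rat monoid"
  where "rat_group = \<lparr>carrier = UNIV, monoid.mult = (+), one = 0\<rparr>"

definition QZ :: "rat set monoid"
  where "QZ = rat_group Mod \<int>"

definition QZ_class :: "rat \<Rightarrow> rat set"
  where "QZ_class q = \<int> #>\<^bsub>rat_group\<^esub> q"

locale group_with_pairing = comm_group \<Gamma>
  for \<Gamma> :: "('a, 'b) monoid_scheme" (structure)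
  and pairing :: "'a \<Rightarrow> 'a \<Rightarrow> rat set" +
  assumes finite_carrier: "finite (carrier \<Gamma>)"
    and pairing_closed: "\<lbrakk>x \<in> carrier \<Gamma>; y \<in> carrier \<Gamma>\<rbrakk> \<Longrightarrow> pairing x y \<in> carrier QZ"
    and pairing_sym: "\<lbrakk>x \<in> carrier \<Gamma>; y \<in> carrier \<Gamma>\<rbrakk> \<Longrightarrow> pairing x y = pairing y x"
    and pairing_mult_left:
      "\<lbrakk>x \<in> carrier \<Gamma>; y \<in> carrier \<Gamma>; z \<in> carrier \<Gamma>\<rbrakk>
        \<Longrightarrow> pairing (x \<otimes> y) z = pairing x z \<otimes>\<^bsub>QZ\<^esub> pairing y z"
    and pairing_mult_right:
      "\<lbrakk>x \<in> carrier \<Gamma>; y \<in> carrier \<Gamma>; z \<in> carrier \<Gamma>\<rbrakk>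
        \<Longrightarrow> pairing x (y \<otimes> z) = pairing x y \<otimes>\<^bsub>QZ\<^esub> pairing x z"
    and pairing_nondegenerate:
      "\<lbrakk>x \<in> carrier \<Gamma>; \<And>y. y \<in> carrier \<Gamma> \<Longrightarrow> pairing x y = \<one>\<^bsub>QZ\<^esub>\<rbrakk> \<Longrightarrow> x = \<one>"

definition pairing_iso ::
  "('a, 'm) monoid_scheme \<Rightarrow> ('a \<Rightarrow> 'a \<Rightarrow> rat set)
    \<Rightarrow> ('b, 'n) monoid_scheme \<Rightarrow> ('b \<Rightarrow> 'b \<Rightarrow> rat set) \<Rightarrow> bool"
  where "pairing_iso \<Gamma> p \<Delta> q \<longleftrightarrow>
    (\<exists>h \<in> iso \<Gamma> \<Delta>. \<forall>x \<in> carrier \<Gamma>. \<forall>y \<in> carrier \<Gamma>. q (h x) (h y) = p x y)"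

definition unit_pairing :: "nat \<Rightarrow> int \<Rightarrow> int \<Rightarrow> int \<Rightarrow> rat set"
  where "unit_pairing r u x y = QZ_class (of_int (u * x * y) / 2 ^ r)"

definition nonexceptional_pairing :: "nat \<Rightarrow> (int \<Rightarrow> int \<Rightarrow> rat set) \<Rightarrow> bool"
  where "nonexceptional_pairing r p \<longleftrightarrow>
    group_with_pairing (integer_mod_group (2 ^ r)) p \<and>
    (\<exists>u. (u = 1 \<and> r \<ge> 1 \<or> u = -1 \<and> r \<ge> 2 \<or> u = 5 \<and> r \<ge> 3 \<or> u = -5 \<and> r \<ge> 3) \<and>
      pairing_iso (integer_mod_group (2 ^ r)) p (integer_mod_group (2 ^ r)) (unit_pairing r u))"


section \<open>Multigraphs and their Jacobians\<close>

text \<open>An edge is the two-element set of its endpoints, and parallel edges are recorded by the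
  multiplicity of that set.\<close>

record 'v mgraph =
  verts :: "'v set"
  edges :: "'v set multiset"

definition connected_loopless_multigraph :: "'v mgraph \<Rightarrow> bool"
  where "connected_loopless_multigraph G \<longleftrightarrow>
    finite (verts G) \<and> verts G \<noteq> {} \<and>
    (\<forall>e \<in># edges G. e \<subseteq> verts G \<and> card e = 2) \<and>
    (\<forall>v \<in> verts G. \<forall>w \<in> verts G. (v, w) \<in> {(a, b). {a, b} \<in># edges G}\<^sup>*)"

definition divisor_degree :: "'v mgraph \<Rightarrow> ('v \<Rightarrow>\<^sub>0 int) \<Rightarrow> int"
  where "divisor_degree G D = (\<Sum>v \<in> verts G. Poly_Mapping.lookup D v)"

definition ord_at :: "'v mgraph \<Rightarrow> ('v \<Rightarrow> int) \<Rightarrow> 'v \<Rightarrow> int"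
  where "ord_at G f v = (\<Sum>e \<in># {#e \<in># edges G. v \<in> e#}. f v - f (the_elem (e - {v})))"

text \<open>Only the values of \<open>f\<close> on the vertices matter here.\<close>

definition divisor_of :: "'v mgraph \<Rightarrow> ('v \<Rightarrow> int) \<Rightarrow> ('v \<Rightarrow>\<^sub>0 int)"
  where "divisor_of G f = (\<Sum>v \<in> verts G. frag_cmul (ord_at G f v) (frag_of v))"

definition principal_divisors :: "'v mgraph \<Rightarrow> ('v \<Rightarrow>\<^sub>0 int) set"
  where "principal_divisors G = range (divisor_of G)"

definition Div0 :: "'v mgraph \<Rightarrow> ('v \<Rightarrow>\<^sub>0 int) monoid"
  where "Div0 G = (free_Abelian_group (verts G))
    \<lparr>carrier := {D \<in> carrier (free_Abelian_group (verts G)). divisor_degree G D = 0}\<rparr>"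

definition Jac :: "'v mgraph \<Rightarrow> ('v \<Rightarrow>\<^sub>0 int) set monoid"
  where "Jac G = Div0 G Mod principal_divisors G"

text \<open>The value does not depend on the representatives \<open>D1\<close>, \<open>D2\<close> of the two classes, nor on the
  choice of \<open>m\<close> and \<open>f\<close>, so the description below is that of a unique element.\<close>

definition monodromy_pairing :: "'v mgraph \<Rightarrow> ('v \<Rightarrow>\<^sub>0 int) set \<Rightarrow> ('v \<Rightarrow>\<^sub>0 int) set \<Rightarrow> rat set"
  where "monodromy_pairing G A B = (THE q. \<exists>D1 \<in> A. \<exists>D2 \<in> B. \<exists>m::int. \<exists>f.
    m \<ge> 1 \<and> divisor_of G f = frag_cmul m D1 \<and>
    q = QZ_class (of_int (\<Sum>v \<in> verts G. Poly_Mapping.lookup D2 v * f v) / of_int m))"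

end

theory Submission
  imports Defs
begin

text \<open>Call a graph with terminals \<open>s \<noteq> t\<close> a \<open>(P, \<tau>)\<close>-network if \<open>t - s\<close> generates the Jacobian and some
  \<open>f\<close> satisfies \<open>div f = \<tau>(t - s)\<close> and \<open>f t - f s = P\<close>. If \<open>P\<close> and \<open>\<tau>\<close> are coprime, Green's identity
  forces \<open>t - s\<close> to have order exactly \<open>\<tau>\<close>, so the Jacobian is \<open>\<int>/\<tau>\<close> with pairing \<open>P x y / \<tau>\<close>.
  A parallel edge turns \<open>(P, \<tau>)\<close> into \<open>(P, P + \<tau>)\<close> and a series edge turns it into \<open>(P + \<tau>, \<tau>)\<close>;
  starting from a single edge, which is \<open>(1, 1)\<close>, the Euclidean algorithm reaches every coprime pair
  of positive integers. For the pairing \<open>u x y / 2\<^sup>r\<close> take \<open>\<tau> = 2\<^sup>r\<close> and \<open>P = u mod 2\<^sup>r\<close>.\<close>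

section \<open>Principal divisors\<close>

text \<open>The coefficient function of the divisor \<open>t - s\<close>. Networks are built with
  plain integer functions; finitely supported maps return only when the Jacobian is formed.\<close>

definition dipole :: "'v \<Rightarrow> 'v \<Rightarrow> 'v \<Rightarrow> int"
  where "dipole s t v = of_bool (v = t) - of_bool (v = s)"

lemma sum_mult_dipole:
  assumes "finite V" "s \<in> V" "t \<in> V"
  shows "(\<Sum>v\<in>V. g v * dipole s t v) = g t - g s"
proof -
  have "(\<Sum>v\<in>V. g v * dipole s t v)
      = (\<Sum>v\<in>V. if v = t then g v else 0) - (\<Sum>v\<in>V. if v = s then g v else 0)"
    unfolding sum_subtractf[symmetric] by (rule sum.cong) (auto simp: dipole_def)
  then show ?thesis
    using assms by simp
qed

lemma ord_at_add: "ord_at G (\<lambda>w. f w + g w) v = ord_at G f v + ord_at G g v"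
  unfolding ord_at_def sum_mset.distrib[symmetric] by (simp add: algebra_simps)

lemma ord_at_mult: "ord_at G (\<lambda>w. c * f w) v = c * ord_at G f v"
  unfolding ord_at_def sum_mset_distrib_left by (simp add: algebra_simps)

text \<open>\<open>ord_at\<close> is additive over edges, and an edge \<open>{a, b}\<close>
  contributes \<open>f b - f a\<close> at \<open>b\<close> and the opposite at \<open>a\<close>.
  Every change of graph below is computed from this formula.\<close>

lemma ord_at_add_edge:
  assumes "a \<noteq> b"
  shows "ord_at (G\<lparr>edges := add_mset {a, b} M\<rparr>) f v
    = ord_at (G\<lparr>edges := M\<rparr>) f v + (f b - f a) * dipole a b v"
proof -
  have "{a, b} - {a} = {b}" "{a, b} - {b} = {a}"
    using assms by auto
  then show ?thesis
    using assms by (auto simp: ord_at_def dipole_def)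
qed

text \<open>Green's identity: each edge \<open>{a, b}\<close> contributes
  \<open>(f b - f a) * (g b - g a)\<close> to either side, which is symmetric in \<open>f\<close>
  and \<open>g\<close>.\<close>

lemma ord_at_green:
  fixes G :: "'v mgraph"
  assumes "finite (verts G)" "\<forall>e \<in># edges G. e \<subseteq> verts G \<and> card e = 2"
  shows "(\<Sum>v\<in>verts G. g v * ord_at G f v) = (\<Sum>v\<in>verts G. f v * ord_at G g v)"
proof -
  \<comment> \<open>The vertex set stays fixed while the edge multiset \<open>M\<close> grows; the
    intermediate graphs may be disconnected.\<close>
  have "(\<Sum>v\<in>verts G. g v * ord_at (G\<lparr>edges := M\<rparr>) f v)
      = (\<Sum>v\<in>verts G. f v * ord_at (G\<lparr>edges := M\<rparr>) g v)"
    if "\<forall>e \<in># M. e \<subseteq> verts G \<and> card e = 2" for M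
    using that
  proof (induction M)
    case empty
    then show ?case by (simp add: ord_at_def)
  next
    case (add e M)
    then obtain a b where e: "e = {a, b}" "a \<noteq> b"
      by (auto simp: card_2_iff)
    with add.prems have ab: "a \<in> verts G" "b \<in> verts G"
      by auto
    have expand: "(\<Sum>v\<in>verts G. h v * ord_at (G\<lparr>edges := add_mset e M\<rparr>) k v)
        = (\<Sum>v\<in>verts G. h v * ord_at (G\<lparr>edges := M\<rparr>) k v) + (k b - k a) * (h b - h a)" for h k
    proof -
      have "(\<Sum>v\<in>verts G. h v * ord_at (G\<lparr>edges := add_mset e M\<rparr>) k v)
        = (\<Sum>v\<in>verts G. h v * ord_at (G\<lparr>edges := M\<rparr>) k v)
          + (k b - k a) * (\<Sum>v\<in>verts G. h v * dipole a b v)"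
        unfolding e(1) ord_at_add_edge[OF e(2)] sum_distrib_left sum.distrib[symmetric]
        by (rule sum.cong) (auto simp: algebra_simps)
      then show ?thesis
        by (simp add: sum_mult_dipole[OF assms(1) ab])
    qed
    have "(\<Sum>v\<in>verts G. g v * ord_at (G\<lparr>edges := M\<rparr>) f v)
      = (\<Sum>v\<in>verts G. f v * ord_at (G\<lparr>edges := M\<rparr>) g v)"
      using add by auto
    then show ?case
      unfolding expand by (simp add: algebra_simps)
  qed
  from this[OF assms(2)] show ?thesis by simp
qed

lemma ord_at_cong:
  assumes "\<forall>e \<in># edges G. e \<subseteq> verts G \<and> card e = 2" "v \<in> verts G" "\<And>w. w \<in> verts G \<Longrightarrow> f w = g w"
  shows "ord_at G f v = ord_at G g v"
proof -
  have "f v - f (the_elem (e - {v})) = g v - g (the_elem (e - {v}))"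
    if "e \<in># edges G" "v \<in> e" for e
  proof -
    obtain a b where e: "e = {a, b}" "a \<noteq> b"
      using assms(1) \<open>e \<in># edges G\<close> by (meson card_2_iff)
    then have "the_elem (e - {v}) \<in> e"
      using \<open>v \<in> e\<close> by (auto simp: insert_Diff_if)
    then show ?thesis
      using assms that(1) by (metis subsetD)
  qed
  then show ?thesis
    unfolding ord_at_def by (intro arg_cong[of _ _ sum_mset] image_mset_cong) auto
qed

lemma ord_at_outside:
  assumes "\<forall>e \<in># edges G. e \<subseteq> verts G" "v \<notin> verts G"
  shows "ord_at G f v = 0"
proof -
  have "{#e \<in># edges G. v \<in> e#} = {#}"
    using assms by auto
  then show ?thesis
    unfolding ord_at_def by (simp only: image_mset_empty sum_mset.empty)
qed

section \<open>Divisors of functions in the free abelian group\<close>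

lemma lookup_divisor_of:
  assumes "finite (verts G)"
  shows "Poly_Mapping.lookup (divisor_of G f) v = (if v \<in> verts G then ord_at G f v else 0)"
  using assms by (simp add: divisor_of_def lookup_sum if_distrib cong: if_cong)

lemma divisor_of_add:
  "divisor_of G (\<lambda>w. f w + g w) = divisor_of G f + divisor_of G g"
  by (simp add: divisor_of_def ord_at_add frag_cmul_distrib sum.distrib)

lemma divisor_of_mult: "divisor_of G (\<lambda>w. c * f w) = frag_cmul c (divisor_of G f)"
  by (simp add: divisor_of_def ord_at_mult frag_cmul_sum)

lemma divisor_of_diff:
  "divisor_of G (\<lambda>w. f w - g w) = divisor_of G f - divisor_of G g"
  using divisor_of_add[of G f "\<lambda>w. (-1) * g w"] unfolding divisor_of_mult by simp

lemma in_carrier_Div0_iff: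
  "E \<in> carrier (Div0 G) \<longleftrightarrow>
    (\<forall>v. v \<notin> verts G \<longrightarrow> Poly_Mapping.lookup E v = 0) \<and> (\<Sum>v\<in>verts G. Poly_Mapping.lookup E v) = 0"
proof -
  have "Poly_Mapping.keys E \<subseteq> verts G \<longleftrightarrow> (\<forall>v. v \<notin> verts G \<longrightarrow> Poly_Mapping.lookup E v = 0)"
    by (metis in_keys_iff subset_iff)
  then show ?thesis
    by (simp add: Div0_def divisor_degree_def)
qed

section \<open>Two-terminal networks\<close>

text \<open>\<open>P / \<tau>\<close> is the effective resistance between the terminals, and \<open>\<tau>\<close> will be the order of the
  Jacobian.\<close>

definition network :: "'v mgraph \<Rightarrow> 'v \<Rightarrow> 'v \<Rightarrow> int \<Rightarrow> int \<Rightarrow> bool"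
  where "network G s t P \<tau> \<longleftrightarrow>
    connected_loopless_multigraph G \<and> s \<in> verts G \<and> t \<in> verts G \<and> s \<noteq> t \<and>
    (\<exists>f. (\<forall>v \<in> verts G. ord_at G f v = \<tau> * dipole s t v) \<and> f t - f s = P) \<and>
    (\<forall>E. (\<Sum>v\<in>verts G. E v) = 0 \<longrightarrow>
      (\<exists>g c. \<forall>v \<in> verts G. E v = ord_at G g v + c * dipole s t v))"

lemma network_obtain_potential:
  assumes "network G s t P \<tau>"
  obtains f where "\<forall>v \<in> verts G. ord_at G f v = \<tau> * dipole s t v" "f t - f s = P"
proof -
  have "\<exists>f. (\<forall>v \<in> verts G. ord_at G f v = \<tau> * dipole s t v) \<and> f t - f s = P"
    using assms unfolding network_def by (elim conjE)
  then show thesis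
    using that by blast
qed

lemma network_obtain_multiple:
  assumes "network G s t P \<tau>" "(\<Sum>v\<in>verts G. E v) = 0"
  obtains g c where "\<forall>v \<in> verts G. E v = ord_at G g v + c * dipole s t v"
proof -
  have "\<forall>E. (\<Sum>v\<in>verts G. E v) = 0 \<longrightarrow>
      (\<exists>g c. \<forall>v \<in> verts G. E v = ord_at G g v + c * dipole s t v)"
    using assms(1) unfolding network_def by (elim conjE)
  from this[THEN spec, THEN mp, OF assms(2)] show thesis
    by (elim exE) (rule that)
qed

section \<open>Building networks edge by edge\<close>

lemma network_single_edge:
  assumes "s \<noteq> t"
  shows "network \<lparr>verts = {s, t}, edges = {#{s, t}#}\<rparr> s t 1 1"
proof -
  let ?G = "\<lparr>verts = {s, t}, edges = {#{s, t}#}\<rparr>"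
  have ord: "ord_at ?G f v = (f t - f s) * dipole s t v" for f v
    using ord_at_add_edge[OF assms, where G = ?G and M = "{#}"] by (simp add: ord_at_def)
  have "(s, t) \<in> {(a, b). {a, b} = {s, t}}" "(t, s) \<in> {(a, b). {a, b} = {s, t}}"
    by auto
  then have "(s, t) \<in> {(a, b). {a, b} = {s, t}}\<^sup>*" "(t, s) \<in> {(a, b). {a, b} = {s, t}}\<^sup>*"
    by (meson r_into_rtrancl)+
  then have "connected_loopless_multigraph ?G"
    using assms by (auto simp: connected_loopless_multigraph_def)
  moreover have "\<exists>f. (\<forall>v \<in> verts ?G. ord_at ?G f v = 1 * dipole s t v) \<and> f t - f s = (1::int)"
    using assms unfolding ord by (intro exI[of _ "\<lambda>v. of_bool (v = t)"]) auto
  \<comment> \<open>Degree zero means \<open>E s = - E t\<close>, so \<open>E\<close> is already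
    \<open>E t\<close> times the dipole.\<close>
  moreover have "\<exists>g c. \<forall>v \<in> verts ?G. E v = ord_at ?G g v + c * dipole s t v"
    if "(\<Sum>v\<in>verts ?G. E v) = 0" for E
    using assms that unfolding ord
    by (intro exI[of _ "\<lambda>_. 0"] exI[of _ "E t"]) (auto simp: dipole_def)
  ultimately show ?thesis
    using assms by (simp add: network_def)
qed

text \<open>The old potential still works: the new edge sees the potential difference
  \<open>P\<close> and so carries \<open>P\<close> further units of flow from terminal to
  terminal.\<close>

lemma network_parallel:
  fixes G :: "'v mgraph"
  assumes "network G s t P \<tau>"
  shows "network (G\<lparr>edges := add_mset {s, t} (edges G)\<rparr>) s t P (P + \<tau>)"
proof -
  let ?G = "G\<lparr>edges := add_mset {s, t} (edges G)\<rparr>"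
  have conn: "connected_loopless_multigraph G" and st: "s \<in> verts G" "t \<in> verts G" "s \<noteq> t"
    using assms by (auto simp: network_def)
  have ord: "ord_at ?G f v = ord_at G f v + (f t - f s) * dipole s t v" for f v
    using ord_at_add_edge[OF st(3), where G = G and M = "edges G"] by simp
  have "{(a, b). {a, b} \<in># edges G}\<^sup>* \<subseteq> {(a, b). {a, b} \<in># edges ?G}\<^sup>*"
    by (rule rtrancl_mono) auto
  then have "\<forall>v \<in> verts ?G. \<forall>w \<in> verts ?G. (v, w) \<in> {(a, b). {a, b} \<in># edges ?G}\<^sup>*"
    using conn unfolding connected_loopless_multigraph_def by (simp add: subset_iff)
  moreover have "\<forall>e \<in># edges ?G. e \<subseteq> verts ?G \<and> card e = 2"
    using conn st unfolding connected_loopless_multigraph_def by simp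
  ultimately have "connected_loopless_multigraph ?G"
    using conn unfolding connected_loopless_multigraph_def by simp
  moreover have "\<exists>f. (\<forall>v \<in> verts G. ord_at ?G f v = (P + \<tau>) * dipole s t v) \<and> f t - f s = P"
  proof -
    obtain f where "\<forall>v \<in> verts G. ord_at G f v = \<tau> * dipole s t v" "f t - f s = P"
      by (rule network_obtain_potential[OF assms])
    then show ?thesis
      unfolding ord by (intro exI[of _ f]) (simp add: algebra_simps)
  qed
  moreover have "\<exists>g c. \<forall>v \<in> verts G. E v = ord_at ?G g v + c * dipole s t v"
    if E: "(\<Sum>v\<in>verts G. E v) = 0" for E
  proof -
    obtain g c where "\<forall>v \<in> verts G. E v = ord_at G g v + c * dipole s t v"
      by (rule network_obtain_multiple[OF assms E])
    \<comment> \<open>The new edge adds \<open>g t - g s\<close> copies of the dipole to the divisor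
      of \<open>g\<close>; the coefficient \<open>c\<close> is lowered by the same amount.\<close>
    then show ?thesis
      unfolding ord by (intro exI[of _ g] exI[of _ "c - (g t - g s)"]) (auto simp: algebra_simps)
  qed
  ultimately show ?thesis
    using st by (simp add: network_def)
qed

text \<open>The whole flow \<tau> must pass through the new edge, so the potential rises by \<tau>
  from \<open>t\<close> to \<open>t'\<close>.\<close>

lemma network_series:
  fixes G :: "'v mgraph"
  assumes "network G s t P \<tau>" "t' \<notin> verts G"
  shows "network (G\<lparr>verts := insert t' (verts G), edges := add_mset {t, t'} (edges G)\<rparr>)
    s t' (P + \<tau>) \<tau>"
proof -
  let ?G = "G\<lparr>verts := insert t' (verts G), edges := add_mset {t, t'} (edges G)\<rparr>"
  have conn: "connected_loopless_multigraph G" and st: "s \<in> verts G" "t \<in> verts G" "s \<noteq> t"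
    using assms by (auto simp: network_def)
  have fin: "finite (verts G)" and edges: "\<forall>e \<in># edges G. e \<subseteq> verts G \<and> card e = 2"
    using conn by (auto simp: connected_loopless_multigraph_def)
  have neq: "t \<noteq> t'" "s \<noteq> t'"
    using st assms(2) by auto
  \<comment> \<open>\<open>ord_at\<close> reads only the edges, so enlarging the vertex set does not
    affect it.\<close>
  have "ord_at ?G f v = ord_at (G\<lparr>edges := add_mset {t, t'} (edges G)\<rparr>) f v" for f v
    by (simp add: ord_at_def)
  then have ord: "ord_at ?G f v = ord_at G f v + (f t' - f t) * dipole t t' v" for f v
    using ord_at_add_edge[OF neq(1), where G = G and M = "edges G"] by simp
  have ord_new: "ord_at G f t' = 0" for f
    using edges assms(2) by (intro ord_at_outside) auto
  have ord_upd: "ord_at G (f(t' := x)) v = ord_at G f v" if "v \<in> verts G" for f x v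
    using edges that assms(2) by (intro ord_at_cong) auto
  have "connected_loopless_multigraph ?G"
  proof -
    let ?R = "{(a, b). {a, b} \<in># edges ?G}"
    have "{(a, b). {a, b} \<in># edges G}\<^sup>* \<subseteq> ?R\<^sup>*"
      by (rule rtrancl_mono) auto
    then have old: "(v, w) \<in> ?R\<^sup>*" if "v \<in> verts G" "w \<in> verts G" for v w
      using conn that unfolding connected_loopless_multigraph_def by blast
    have new: "(t, t') \<in> ?R" "(t', t) \<in> ?R"
      by (auto simp: insert_commute)
    \<comment> \<open>Any two vertices are then joined by a path through \<open>t\<close>.\<close>
    have "(v, t) \<in> ?R\<^sup>*" "(t, v) \<in> ?R\<^sup>*" if "v \<in> verts ?G" for v
      using that old[of v t] old[of t v] st(2) new[THEN r_into_rtrancl] by (cases "v = t'"; simp)+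
    then have "\<forall>v \<in> verts ?G. \<forall>w \<in> verts ?G. (v, w) \<in> ?R\<^sup>*"
      by (meson rtrancl_trans)
    moreover have "\<forall>e \<in># edges ?G. e \<subseteq> verts ?G \<and> card e = 2"
      using edges st neq by auto
    ultimately show ?thesis
      using fin unfolding connected_loopless_multigraph_def by simp
  qed
  moreover have "\<exists>f. (\<forall>v \<in> verts ?G. ord_at ?G f v = \<tau> * dipole s t' v) \<and> f t' - f s = P + \<tau>"
  proof -
    obtain f where f: "\<forall>v \<in> verts G. ord_at G f v = \<tau> * dipole s t v" "f t - f s = P"
      by (rule network_obtain_potential[OF assms(1)])
    show ?thesis
      unfolding ord using f neq
      by (intro exI[of _ "f(t' := f t + \<tau>)"])
        (auto simp: ord_new ord_upd dipole_def algebra_simps)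
  qed
  moreover have "\<exists>g c. \<forall>v \<in> verts ?G. E v = ord_at ?G g v + c * dipole s t' v"
    if E: "(\<Sum>v\<in>verts ?G. E v) = 0" for E
  proof -
    \<comment> \<open>Moving the coefficient at \<open>t'\<close> back to \<open>t\<close> gives a
      degree-zero divisor on the old graph.\<close>
    have "(\<Sum>v\<in>verts G. E v + E t' * of_bool (v = t)) = 0"
      using E fin assms(2) st unfolding sum.distrib sum_distrib_left[symmetric] by simp
    then obtain g c where g: "\<forall>v \<in> verts G. E v + E t' * of_bool (v = t)
        = ord_at G g v + c * dipole s t v"
      by (rule network_obtain_multiple[OF assms(1)])
    \<comment> \<open>The value at \<open>t'\<close> solves \<open>E t' = (g t' - g t) + c\<close>,
      the equation at the new vertex; the one at \<open>t\<close> then balances as well.\<close>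
    show ?thesis
      unfolding ord using g neq
      by (intro exI[of _ "g(t' := g t + E t' - c)"] exI[of _ c])
        (auto simp: ord_new ord_upd dipole_def algebra_simps)
  qed
  ultimately show ?thesis
    using st neq by (simp add: network_def)
qed

text \<open>The subtractive Euclidean algorithm, run as strong induction on
  \<open>P + \<tau>\<close>: the smaller entry is subtracted from the larger, and the matching edge
  is added back.\<close>

lemma network_exists:
  fixes P \<tau> :: int
  assumes "P > 0" "\<tau> > 0" "coprime P \<tau>"
  shows "\<exists>(G :: nat mgraph) s t. network G s t P \<tau>"
  using assms
proof (induction "nat (P + \<tau>)" arbitrary: P \<tau> rule: less_induct)
  case less
  consider "P = \<tau>" | "P < \<tau>" | "\<tau> < P"
    by linarith
  then show ?case
  proof cases
    case 1
    then have "P = 1" "\<tau> = 1"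
      using less.prems by auto
    then show ?thesis
      using network_single_edge[of "0::nat" 1] by auto
  next
    case 2
    have "coprime P (\<tau> - P)"
      using less.prems by (metis coprime_iff_gcd_eq_1 gcd_diff1 gcd.commute)
    then obtain G :: "nat mgraph" and s t where "network G s t P (\<tau> - P)"
      using less.hyps[of P "\<tau> - P"] less.prems 2 by auto
    from network_parallel[OF this] show ?thesis
      by auto
  next
    case 3
    have "coprime (P - \<tau>) \<tau>"
      using less.prems by (metis coprime_iff_gcd_eq_1 gcd_diff1)
    then obtain G :: "nat mgraph" and s t where G: "network G s t (P - \<tau>) \<tau>"
      using less.hyps[of "P - \<tau>" \<tau>] less.prems 3 by auto
    then have "finite (verts G)"
      by (simp add: network_def connected_loopless_multigraph_def)
    then obtain t' where "t' \<notin> verts G"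
      using ex_new_if_finite infinite_UNIV_nat by blast
    from network_series[OF G this] show ?thesis
      by auto
  qed
qed

section \<open>The Jacobian of a network\<close>

lemma QZ_class_eqI:
  assumes "q - q' \<in> \<int>"
  shows "QZ_class q = QZ_class q'"
proof -
  have mem: "x \<in> QZ_class y \<longleftrightarrow> x - y \<in> \<int>" for x y
    by (auto simp: QZ_class_def rat_group_def r_coset_def) (metis diff_add_cancel)
  have "x - q \<in> \<int> \<longleftrightarrow> x - q' \<in> \<int>" for x
    using Ints_add[OF _ assms, of "x - q"] Ints_diff[OF _ assms, of "x - q'"] by auto
  then show ?thesis
    using mem by blast
qed

text \<open>Describing cosets by explicit membership reduces computation in the quotient to
  additivity of \<open>divisor_of\<close>.\<close>

lemma mem_Div0_coset:
  "X \<in> principal_divisors G #>\<^bsub>Div0 G\<^esub> E \<longleftrightarrow> (\<exists>g. X = divisor_of G g + E)"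
  by (auto simp: r_coset_def Div0_def principal_divisors_def)

lemma Div0_coset_eq_iff:
  "principal_divisors G #>\<^bsub>Div0 G\<^esub> E = principal_divisors G #>\<^bsub>Div0 G\<^esub> E'
    \<longleftrightarrow> (\<exists>g. E - E' = divisor_of G g)"
proof
  assume "principal_divisors G #>\<^bsub>Div0 G\<^esub> E = principal_divisors G #>\<^bsub>Div0 G\<^esub> E'"
  moreover have "E \<in> principal_divisors G #>\<^bsub>Div0 G\<^esub> E"
    unfolding mem_Div0_coset by (rule exI[of _ "\<lambda>_. 0"]) (simp add: divisor_of_def ord_at_def)
  ultimately show "\<exists>g. E - E' = divisor_of G g"
    unfolding mem_Div0_coset by (metis mem_Div0_coset add_diff_cancel_right')
next
  assume "\<exists>g. E - E' = divisor_of G g"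
  then obtain g where g: "E = divisor_of G g + E'"
    by (metis diff_add_cancel)
  have "\<exists>k. divisor_of G h + E = divisor_of G k + E'" for h
    unfolding g by (rule exI[of _ "\<lambda>v. h v + g v"]) (simp add: divisor_of_add add.assoc)
  moreover have "\<exists>k. divisor_of G h + E' = divisor_of G k + E" for h
    unfolding g by (rule exI[of _ "\<lambda>v. h v - g v"]) (simp add: divisor_of_diff)
  ultimately show "principal_divisors G #>\<^bsub>Div0 G\<^esub> E = principal_divisors G #>\<^bsub>Div0 G\<^esub> E'"
    unfolding set_eq_iff mem_Div0_coset by metis
qed

lemma Div0_coset_mult:
  "(principal_divisors G #>\<^bsub>Div0 G\<^esub> E) <#>\<^bsub>Div0 G\<^esub> (principal_divisors G #>\<^bsub>Div0 G\<^esub> E')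
    = principal_divisors G #>\<^bsub>Div0 G\<^esub> (E + E')" (is "?L = ?R")
proof (rule Set.set_eqI)
  fix X
  have "X \<in> ?L \<longleftrightarrow> (\<exists>g h. X = (divisor_of G g + E) + (divisor_of G h + E'))"
  proof -
    have "X \<in> ?L \<longleftrightarrow> (\<exists>x \<in> principal_divisors G #>\<^bsub>Div0 G\<^esub> E.
        \<exists>y \<in> principal_divisors G #>\<^bsub>Div0 G\<^esub> E'. X = x + y)"
      by (simp add: set_mult_def Div0_def)
    then show ?thesis
      unfolding Bex_def mem_Div0_coset by blast
  qed
  also have "\<dots> \<longleftrightarrow> (\<exists>g h. X = divisor_of G (\<lambda>v. g v + h v) + (E + E'))"
    by (simp add: divisor_of_add algebra_simps)
  also have "\<dots> \<longleftrightarrow> (\<exists>k. X = divisor_of G k + (E + E'))"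
  proof
    assume "\<exists>k. X = divisor_of G k + (E + E')"
    then obtain k where "X = divisor_of G (\<lambda>v. k v + 0) + (E + E')"
      by auto
    then show "\<exists>g h. X = divisor_of G (\<lambda>v. g v + h v) + (E + E')"
      by (intro exI[of _ k] exI[of _ "\<lambda>_. 0"])
  qed blast
  finally show "X \<in> ?L \<longleftrightarrow> X \<in> ?R"
    by (simp add: mem_Div0_coset)
qed

section \<open>Order, generation and pairing for a coprime network\<close>

locale two_terminal_network =
  fixes G :: "'v mgraph" and s t :: 'v and P \<tau> :: int
  assumes network: "network G s t P \<tau>" and \<tau>_pos: "\<tau> > 0" and coprime: "coprime P \<tau>"
begin

lemma terminals: "s \<in> verts G" "t \<in> verts G" "s \<noteq> t"
  using network by (auto simp: network_def)

lemma finite_verts: "finite (verts G)"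
  and loopless: "\<forall>e \<in># edges G. e \<subseteq> verts G \<and> card e = 2"
  using network by (auto simp: network_def connected_loopless_multigraph_def)

definition terminal_divisor :: "'v \<Rightarrow>\<^sub>0 int"
  where "terminal_divisor = frag_of t - frag_of s"

text \<open>This map, restricted to residues modulo \<tau>, becomes the isomorphism onto the
  Jacobian.\<close>

definition terminal_class :: "int \<Rightarrow> ('v \<Rightarrow>\<^sub>0 int) set"
  where "terminal_class k = principal_divisors G #>\<^bsub>Div0 G\<^esub> frag_cmul k terminal_divisor"

lemma lookup_terminal_divisor: "Poly_Mapping.lookup terminal_divisor v = dipole s t v"
  by (simp add: terminal_divisor_def lookup_minus dipole_def)

lemma obtain_potential:
  obtains \<phi> where "divisor_of G \<phi> = frag_cmul \<tau> terminal_divisor" "\<phi> t - \<phi> s = P"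
proof -
  obtain \<phi> where \<phi>: "\<forall>v \<in> verts G. ord_at G \<phi> v = \<tau> * dipole s t v" "\<phi> t - \<phi> s = P"
    by (rule network_obtain_potential[OF network])
  have "divisor_of G \<phi> = frag_cmul \<tau> terminal_divisor"
    by (rule poly_mapping_eqI)
      (use \<phi> terminals in \<open>auto simp: lookup_divisor_of finite_verts lookup_terminal_divisor dipole_def\<close>)
  with \<phi>(2) show thesis
    using that by blast
qed

text \<open>The numerator in \<open>monodromy_pairing\<close>, written so that it can be folded
  there literally.\<close>

definition evaluation :: "('v \<Rightarrow>\<^sub>0 int) \<Rightarrow> ('v \<Rightarrow> int) \<Rightarrow> int"
  where "evaluation D f = (\<Sum>v\<in>verts G. Poly_Mapping.lookup D v * f v)"

lemma evaluation_add: "evaluation (D + E) f = evaluation D f + evaluation E f"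
  by (simp add: evaluation_def lookup_add sum.distrib algebra_simps)

lemma evaluation_cmul: "evaluation (frag_cmul c D) f = c * evaluation D f"
  by (simp add: evaluation_def sum_distrib_left algebra_simps)

lemma evaluation_terminal: "evaluation terminal_divisor f = f t - f s"
  using sum_mult_dipole[OF finite_verts terminals(1,2)]
  by (simp add: evaluation_def lookup_terminal_divisor mult.commute)

lemma evaluation_green: "evaluation (divisor_of G f) g = evaluation (divisor_of G g) f"
  using ord_at_green[OF finite_verts loopless, of g f]
  by (simp add: evaluation_def lookup_divisor_of finite_verts mult.commute)

lemma terminal_divisor_in_Div0: "frag_cmul k terminal_divisor \<in> carrier (Div0 G)"
proof -
  \<comment> \<open>Evaluation at the constant function 1 is the degree.\<close>
  have "evaluation (frag_cmul k terminal_divisor) (\<lambda>_. 1) = 0"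
    unfolding evaluation_cmul evaluation_terminal by simp
  then show ?thesis
    using terminals by (auto simp: in_carrier_Div0_iff evaluation_def lookup_terminal_divisor dipole_def)
qed

text \<open>If \<open>c\<close> times the terminal divisor is the divisor of \<open>g\<close>,
  evaluating it at the potential \<phi> and applying Green's identity gives
  \<open>c * P = \<tau> * (g t - g s)\<close>; coprimality then yields \<open>\<tau> dvd c\<close>.
  Conversely, multiples of \<phi> realise all multiples of \<tau>.\<close>

lemma terminal_class_eq_iff: "terminal_class k = terminal_class l \<longleftrightarrow> \<tau> dvd k - l"
proof -
  obtain \<phi> where \<phi>: "divisor_of G \<phi> = frag_cmul \<tau> terminal_divisor" "\<phi> t - \<phi> s = P"
    by (rule obtain_potential)
  have "\<tau> dvd c" if "frag_cmul c terminal_divisor = divisor_of G g" for c g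
  proof -
    have "c * P = evaluation (divisor_of G g) \<phi>"
      by (simp flip: that add: evaluation_cmul evaluation_terminal \<phi>(2))
    also have "\<dots> = \<tau> * (g t - g s)"
      unfolding evaluation_green[of g] \<phi>(1) evaluation_cmul evaluation_terminal ..
    finally have "\<tau> dvd c * P"
      by simp
    then show ?thesis
      using coprime by (simp add: coprime_dvd_mult_left_iff coprime_commute)
  qed
  moreover have "\<exists>g. frag_cmul c terminal_divisor = divisor_of G g" if dvd: "\<tau> dvd c" for c
  proof -
    obtain d where "c = \<tau> * d"
      using dvd by (rule dvdE)
    then have "frag_cmul c terminal_divisor = divisor_of G (\<lambda>v. d * \<phi> v)"
      by (simp add: divisor_of_mult \<phi>(1) mult.commute)
    then show ?thesis by blast
  qed
  ultimately show ?thesis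
    unfolding terminal_class_def Div0_coset_eq_iff frag_cmul_diff_distrib[symmetric] by blast
qed

text \<open>Surjectivity is the generation clause of \<open>network\<close>, carried over to
  finitely supported maps, where both sides vanish off the vertices.\<close>

lemma carrier_Jac: "carrier (Jac G) = range terminal_class"
proof -
  have "\<exists>k. principal_divisors G #>\<^bsub>Div0 G\<^esub> E = terminal_class k"
    if "E \<in> carrier (Div0 G)" for E
  proof -
    have E: "\<And>v. v \<notin> verts G \<Longrightarrow> Poly_Mapping.lookup E v = 0"
        "(\<Sum>v\<in>verts G. Poly_Mapping.lookup E v) = 0"
      using that by (auto simp: in_carrier_Div0_iff)
    obtain g c where
      g: "\<forall>v \<in> verts G. Poly_Mapping.lookup E v = ord_at G g v + c * dipole s t v"
      by (rule network_obtain_multiple[OF network E(2)])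
    have "E - frag_cmul c terminal_divisor = divisor_of G g"
    proof (rule poly_mapping_eqI)
      fix v
      show "Poly_Mapping.lookup (E - frag_cmul c terminal_divisor) v
        = Poly_Mapping.lookup (divisor_of G g) v"
      proof (cases "v \<in> verts G")
        case True
        then show ?thesis
          using g by (simp add: lookup_minus lookup_divisor_of finite_verts lookup_terminal_divisor)
      next
        case False
        then have "Poly_Mapping.lookup E v = 0" "dipole s t v = 0"
          using E(1) terminals by (auto simp: dipole_def)
        with False show ?thesis
          by (simp add: lookup_minus lookup_divisor_of finite_verts lookup_terminal_divisor)
      qed
    qed
    then show ?thesis
      unfolding terminal_class_def Div0_coset_eq_iff by blast
  qed
  moreover have "terminal_class k \<in> carrier (Jac G)" for k
    unfolding Jac_def carrier_FactGroup terminal_class_def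
    by (rule imageI) (rule terminal_divisor_in_Div0)
  ultimately show ?thesis
    unfolding Jac_def carrier_FactGroup by blast
qed

lemma monodromy_pairing_terminal_class:
  "monodromy_pairing G (terminal_class k) (terminal_class l) = QZ_class (of_int (P * k * l) / of_int \<tau>)"
proof -
  obtain \<phi> where \<phi>: "divisor_of G \<phi> = frag_cmul \<tau> terminal_divisor" "\<phi> t - \<phi> s = P"
    by (rule obtain_potential)
  \<comment> \<open>Every admissible choice yields the same class, as the definite description
    requires. The numerator is multiplied by \<tau> so that \<phi> can be brought in without
    division.\<close>
  have well_defined: "QZ_class (of_int (evaluation D2 f) / of_int m) = QZ_class (of_int (P * k * l) / of_int \<tau>)"
    if D1: "D1 \<in> terminal_class k" and D2: "D2 \<in> terminal_class l"
      and m: "m \<ge> 1" and f: "divisor_of G f = frag_cmul m D1" for D1 D2 m f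
  proof -
    obtain a where a: "D1 = divisor_of G a + frag_cmul k terminal_divisor"
      using D1 by (auto simp: terminal_class_def mem_Div0_coset)
    obtain b where b: "D2 = divisor_of G b + frag_cmul l terminal_divisor"
      using D2 by (auto simp: terminal_class_def mem_Div0_coset)
    \<comment> \<open>Green's identity moves the principal part of \<open>D2\<close> onto
      \<open>f\<close>, whose divisor is \<open>m\<close> times \<open>D1\<close>; that term is
      therefore integral after division by \<open>m\<close>.\<close>
    have D2_f: "evaluation D2 f = m * evaluation D1 b + l * (f t - f s)"
      unfolding b evaluation_add evaluation_cmul evaluation_green[of b] f evaluation_terminal ..
    \<comment> \<open>The potential difference of \<open>f\<close> is found by evaluating the
      divisor of \<phi> at \<open>f\<close> and exchanging the two; a second exchange handles
      \<open>a\<close>.\<close>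
    have f_terminals: "\<tau> * (f t - f s) = m * (\<tau> * (a t - a s) + k * P)"
    proof -
      have "\<tau> * (f t - f s) = evaluation (divisor_of G \<phi>) f"
        by (simp add: \<phi>(1) evaluation_cmul evaluation_terminal)
      also have "\<dots> = m * (evaluation (divisor_of G \<phi>) a + k * P)"
        unfolding evaluation_green[of \<phi>] f a evaluation_cmul evaluation_add evaluation_terminal \<phi>(2) ..
      finally show ?thesis
        by (simp add: \<phi>(1) evaluation_cmul evaluation_terminal)
    qed
    have "\<tau> * evaluation D2 f = m * \<tau> * evaluation D1 b + l * (\<tau> * (f t - f s))"
      unfolding D2_f by (simp add: algebra_simps)
    also have "\<dots> = m * (\<tau> * (evaluation D1 b + l * (a t - a s)) + P * k * l)"
      unfolding f_terminals by (simp add: algebra_simps)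
    finally have "of_int \<tau> * of_int (evaluation D2 f)
        = (of_int m * (of_int \<tau> * of_int (evaluation D1 b + l * (a t - a s)) + of_int (P * k * l)) :: rat)"
      by (metis of_int_add of_int_mult)
    then have "of_int (evaluation D2 f) / of_int m - of_int (P * k * l) / of_int \<tau>
        = (of_int (evaluation D1 b + l * (a t - a s)) :: rat)"
      using m \<tau>_pos by (simp add: field_simps)
    then show ?thesis
      by (intro QZ_class_eqI) (metis Ints_of_int)
  qed
  have refl: "frag_cmul k terminal_divisor \<in> terminal_class k" for k
    unfolding terminal_class_def mem_Div0_coset
    by (rule exI[of _ "\<lambda>_. 0"]) (simp add: divisor_of_def ord_at_def)
  \<comment> \<open>An admissible choice exists: \<open>m = \<tau>\<close> with the function
    \<open>k * \<phi>\<close>.\<close>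
  have witness: "divisor_of G (\<lambda>v. k * \<phi> v) = frag_cmul \<tau> (frag_cmul k terminal_divisor)"
    by (simp add: divisor_of_mult \<phi>(1) mult.commute)
  show ?thesis
    unfolding monodromy_pairing_def evaluation_def[symmetric]
  proof (rule the_equality)
    show "\<exists>D1\<in>terminal_class k. \<exists>D2\<in>terminal_class l. \<exists>m::int. \<exists>f.
      1 \<le> m \<and> divisor_of G f = frag_cmul m D1 \<and>
      QZ_class (of_int (P * k * l) / of_int \<tau>) = QZ_class (of_int (evaluation D2 f) / of_int m)"
      using well_defined[OF refl refl _ witness] refl witness \<tau>_pos
      by (metis int_one_le_iff_zero_less)
  qed (use well_defined in blast)
qed

text \<open>Only the residue of \<open>P\<close> modulo \<tau> affects the pairing, so a positive
  \<open>P\<close> can also represent a negative \<open>u\<close>.\<close>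

lemma pairing_iso_Jac:
  assumes "\<tau> = 2 ^ r" "\<tau> dvd P - u"
  shows "pairing_iso (integer_mod_group (2 ^ r)) (unit_pairing r u) (Jac G) (monodromy_pairing G)"
proof -
  have carrier: "carrier (integer_mod_group (2 ^ r)) = {0..<\<tau>}"
    by (simp add: carrier_integer_mod_group assms(1))
  \<comment> \<open>Addition in \<open>integer_mod_group\<close> reduces modulo \<tau>; this absorbs
    the reduction, and also brings any \<open>k\<close> into \<open>{0..<\<tau>}\<close> for
    surjectivity.\<close>
  have mod: "terminal_class (k mod \<tau>) = terminal_class k" for k
    unfolding terminal_class_eq_iff by (metis dvd_minus_mod dvd_diff_commute)
  have "terminal_class \<in> hom (integer_mod_group (2 ^ r)) (Jac G)"
  proof (rule homI)
    fix k l :: int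
    have "terminal_class k \<otimes>\<^bsub>Jac G\<^esub> terminal_class l = terminal_class (k + l)"
      by (simp add: Jac_def terminal_class_def Div0_coset_mult frag_cmul_distrib)
    then show "terminal_class (k \<otimes>\<^bsub>integer_mod_group (2 ^ r)\<^esub> l)
        = terminal_class k \<otimes>\<^bsub>Jac G\<^esub> terminal_class l"
      using mod assms(1) by simp
  qed (simp add: carrier_Jac)
  moreover have "bij_betw terminal_class {0..<\<tau>} (carrier (Jac G))"
  proof (rule bij_betw_imageI)
    show "inj_on terminal_class {0..<\<tau>}"
    proof (rule inj_onI)
      fix k l :: int
      assume "k \<in> {0..<\<tau>}" "l \<in> {0..<\<tau>}" "terminal_class k = terminal_class l"
      then show "k = l"
        by (metis terminal_class_eq_iff atLeastLessThan_iff mod_eq_dvd_iff mod_pos_pos_trivial)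
    qed
    show "terminal_class ` {0..<\<tau>} = carrier (Jac G)"
    proof -
      have "terminal_class k \<in> terminal_class ` {0..<\<tau>}" for k
        using mod[of k] \<tau>_pos by (metis atLeastLessThan_iff imageI pos_mod_bound pos_mod_sign)
      then show ?thesis
        by (auto simp: carrier_Jac)
    qed
  qed
  ultimately have "terminal_class \<in> iso (integer_mod_group (2 ^ r)) (Jac G)"
    by (simp add: iso_def carrier)
  moreover have "monodromy_pairing G (terminal_class k) (terminal_class l) = unit_pairing r u k l" for k l
  proof -
    obtain c where c: "P = u + \<tau> * c"
      using assms(2) by (metis dvdE add.commute diff_add_cancel)
    have "of_int (P * k * l) / of_int \<tau> - of_int (u * k * l) / of_int \<tau> = (of_int (c * k * l) :: rat)"
      using \<tau>_pos by (simp add: c field_simps)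
    moreover have "(of_int \<tau> :: rat) = 2 ^ r"
      by (simp add: assms(1))
    ultimately show ?thesis
      unfolding monodromy_pairing_terminal_class unit_pairing_def
      by (intro QZ_class_eqI) (metis Ints_of_int)
  qed
  ultimately show ?thesis
    unfolding pairing_iso_def by blast
qed

end

section \<open>Composing the isomorphisms\<close>

lemma pairing_iso_trans:
  assumes "pairing_iso A p B q" "pairing_iso B q C r"
  shows "pairing_iso A p C r"
proof -
  obtain h k where h: "h \<in> iso A B" "\<forall>x \<in> carrier A. \<forall>y \<in> carrier A. q (h x) (h y) = p x y"
    and k: "k \<in> iso B C" "\<forall>x \<in> carrier B. \<forall>y \<in> carrier B. r (k x) (k y) = q x y"
    using assms unfolding pairing_iso_def by blast
  have "h x \<in> carrier B" if "x \<in> carrier A" for x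
    using h(1) that by (auto simp: iso_def hom_def)
  then show ?thesis
    unfolding pairing_iso_def using iso_set_trans[OF h(1) k(1)] h(2) k(2)
    by (intro bexI[of _ "k \<circ> h"]) auto
qed

theorem theorem4:
  fixes \<Gamma> :: "('a, 'b) monoid_scheme"
    and b :: "'a \<Rightarrow> 'a \<Rightarrow> rat set"
    and p :: "int \<Rightarrow> int \<Rightarrow> rat set"
    and r :: nat
  assumes "r \<ge> 1"
    and "group_with_pairing \<Gamma> b"
    and "nonexceptional_pairing r p"
    and "pairing_iso \<Gamma> b (integer_mod_group (2 ^ r)) p"
  shows "\<exists>G :: nat mgraph. connected_loopless_multigraph G \<and>
    pairing_iso \<Gamma> b (Jac G) (monodromy_pairing G)"
proof -
  obtain u :: int where "u = 1 \<or> u = -1 \<or> u = 5 \<or> u = -5"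
    and u: "pairing_iso (integer_mod_group (2 ^ r)) p (integer_mod_group (2 ^ r)) (unit_pairing r u)"
    using assms(3) unfolding nonexceptional_pairing_def by blast
  then have "odd u"
    by auto
  \<comment> \<open>Since \<open>r \<ge> 1\<close> the modulus is even, so the residue of the odd
    \<open>u\<close> is odd, hence nonzero and coprime to the modulus.\<close>
  define P :: int where "P = u mod 2 ^ r"
  have "odd P"
    using \<open>odd u\<close> assms(1) by (simp add: P_def dvd_mod_iff)
  then have "coprime P (2 ^ r)"
    by simp
  moreover have "P \<ge> 0"
    by (simp add: P_def)
  then have "P > 0"
    using \<open>odd P\<close> by (cases "P = 0") auto
  ultimately obtain G :: "nat mgraph" and s t where G: "network G s t P (2 ^ r)"
    using network_exists[of P "2 ^ r"] by auto
  interpret two_terminal_network G s t P "2 ^ r"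
    using G \<open>coprime P (2 ^ r)\<close> by unfold_locales auto
  have "2 ^ r dvd P - u"
    unfolding P_def by (metis dvd_minus_mod dvd_diff_commute)
  then have "pairing_iso \<Gamma> b (Jac G) (monodromy_pairing G)"
    using pairing_iso_trans[OF assms(4) pairing_iso_trans[OF u pairing_iso_Jac[OF refl]]] by simp
  moreover have "connected_loopless_multigraph G"
    using G by (simp add: network_def)
  ultimately show ?thesis
    by blast
qed

end
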